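(* Let $A$ be a real $n\times n$ matrix and let $q_A(x_1,\dots,x_n):=\det(\operatorname{diag}(x_1,\dots,x_n)+A)$. If $A$ is a $Z$-matrix, then $q_A$ is a multi-affine Gårding polynomial. If $A$ is an $M$-matrix, then $q_A$ is a multi-affine Gårding polynomial with nonnegative coefficients.
   Context: A real square matrix is a $Z$-matrix if all its off-diagonal entries are nonpositive. A $Z$-matrix $A$ is an $M$-matrix if all its principal minors are nonnegative; equivalently, $A+\epsilon I_n$ is nonsingular for every $\epsilon>0$; equivalently, $A=sI_n-B$ where $B$ has nonnegative entries and $s\ge\rho(B)$ (spectral radius). Let $\Gamma_n^+=\{x\in\mathbb{R}^n:x_i>0\ \forall i\}$. A nonzero multi-affine polynomial $f$ (degree at most 1 in each variable) is Gårding if some nonempty connected component $R$ of $\{f>0\}$ satisfies $R+\overline{\Gamma_n^+}\subset R$. *)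

theory Defs
  imports "HOL-Analysis.Analysis" "HOL-Library.Poly_Mapping"
begin

text \<open>
  Real polynomials in the variables indexed by \<open>'n\<close>: finitely supported maps from
  exponent vectors to coefficients, with the convolution ring structure of
  \<^theory>\<open>HOL-Library.Poly_Mapping\<close>.
\<close>

type_synonym 'n real_mpoly = "('n \<Rightarrow>\<^sub>0 nat) \<Rightarrow>\<^sub>0 real"

definition mpoly_const :: "real \<Rightarrow> 'n real_mpoly" where
  "mpoly_const c = Poly_Mapping.single 0 c"

definition mpoly_var :: "'n \<Rightarrow> 'n real_mpoly" where
  "mpoly_var i = Poly_Mapping.single (Poly_Mapping.single i 1) 1"

definition mpoly_eval :: "('n::finite) real_mpoly \<Rightarrow> real ^ 'n \<Rightarrow> real" where
  "mpoly_eval p x =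
     (\<Sum>m\<in>Poly_Mapping.keys p.
        Poly_Mapping.lookup p m * (\<Prod>i\<in>UNIV. (x $ i) ^ Poly_Mapping.lookup m i))"

definition multi_affine :: "'n real_mpoly \<Rightarrow> bool" where
  "multi_affine p \<longleftrightarrow> (\<forall>m\<in>Poly_Mapping.keys p. \<forall>i. Poly_Mapping.lookup m i \<le> 1)"

definition nonneg_coeffs :: "'n real_mpoly \<Rightarrow> bool" where
  "nonneg_coeffs p \<longleftrightarrow> (\<forall>m. 0 \<le> Poly_Mapping.lookup p m)"

definition pos_orthant :: "(real ^ 'n) set" where
  "pos_orthant = {x. \<forall>i. 0 < x $ i}"

text \<open>Members of \<^const>\<open>components\<close> are nonempty by definition.\<close>

definition garding :: "('n::finite) real_mpoly \<Rightarrow> bool" where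
  "garding f \<longleftrightarrow> f \<noteq> 0 \<and> multi_affine f \<and>
     (\<exists>R \<in> components {x. 0 < mpoly_eval f x}.
        {x + y | x y. x \<in> R \<and> y \<in> closure pos_orthant} \<subseteq> R)"

definition Z_matrix :: "real ^ 'n ^ 'n \<Rightarrow> bool" where
  "Z_matrix A \<longleftrightarrow> (\<forall>i j. i \<noteq> j \<longrightarrow> A $ i $ j \<le> 0)"

text \<open>
  The determinant of the submatrix with rows and columns in \<open>S\<close>. Since \<^const>\<open>det\<close> takes
  its index set from a type, its Leibniz formula is written out over \<open>S\<close>.
\<close>

definition principal_minor :: "real ^ 'n ^ 'n \<Rightarrow> 'n set \<Rightarrow> real" where
  "principal_minor A S = (\<Sum>p | p permutes S. of_int (sign p) * (\<Prod>i\<in>S. A $ i $ p i))"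

lemma principal_minor_UNIV: "principal_minor A UNIV = det A"
  by (simp add: principal_minor_def det_def)

definition M_matrix :: "real ^ 'n ^ 'n \<Rightarrow> bool" where
  "M_matrix A \<longleftrightarrow> Z_matrix A \<and> (\<forall>S. 0 \<le> principal_minor A S)"

text \<open>The determinant is taken in the polynomial ring, so this is a formal polynomial.\<close>

definition q_poly :: "real ^ 'n ^ 'n \<Rightarrow> ('n::finite) real_mpoly" where
  "q_poly A = det ((\<chi> i j. if i = j then mpoly_var i else 0) + (\<chi> i j. mpoly_const (A $ i $ j)))"

lemma mpoly_eval_superset:
  assumes "finite F" "Poly_Mapping.keys p \<subseteq> F"
  shows "mpoly_eval p x =
    (\<Sum>m\<in>F. Poly_Mapping.lookup p m * (\<Prod>i\<in>UNIV. (x $ i) ^ Poly_Mapping.lookup m i))"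
  unfolding mpoly_eval_def using assms
  by (intro sum.mono_neutral_left) (auto simp: in_keys_iff)

lemma mpoly_eval_zero [simp]: "mpoly_eval 0 x = 0"
  by (simp add: mpoly_eval_def)

lemma mpoly_eval_single [simp]:
  "mpoly_eval (Poly_Mapping.single m c) x = c * (\<Prod>i\<in>UNIV. (x $ i) ^ Poly_Mapping.lookup m i)"
  by (subst mpoly_eval_superset[of "{m}"]) (auto simp: lookup_single)

lemma mpoly_eval_add [simp]: "mpoly_eval (p + q) x = mpoly_eval p x + mpoly_eval q x"
proof -
  let ?F = "Poly_Mapping.keys p \<union> Poly_Mapping.keys q"
  have sub: "Poly_Mapping.keys (p + q) \<subseteq> ?F"
    by (rule Poly_Mapping.keys_add)
  show ?thesis
    using mpoly_eval_superset[of ?F "p + q" x, OF _ sub]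
      mpoly_eval_superset[of ?F p x] mpoly_eval_superset[of ?F q x]
    by (simp add: lookup_add distrib_right sum.distrib)
qed

lemma mpoly_eval_uminus [simp]: "mpoly_eval (- p) x = - mpoly_eval p x"
  using mpoly_eval_add[of p "- p" x] by simp

lemma mpoly_eval_one [simp]: "mpoly_eval 1 x = 1"
  by (simp add: mpoly_eval_single[of 0 1 x, simplified])

lemma poly_mapping_single_add_induct [case_names zero single_add]:
  assumes "P 0" and "\<And>m c p. P p \<Longrightarrow> P (p + Poly_Mapping.single m c)"
  shows "P p"
proof (induction p rule: update_induct)
  case (update f a b)
  have "Poly_Mapping.update a b f = f + Poly_Mapping.single a b"
    using update(1)
    by (intro poly_mapping_eqI)
      (auto simp: lookup_update lookup_add lookup_single when_def in_keys_iff)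
  then show ?case
    using assms(2) update(3) by simp
qed (fact assms(1))

lemma mpoly_eval_mult [simp]: "mpoly_eval (p * q) x = mpoly_eval p x * mpoly_eval q x"
proof (induction p rule: poly_mapping_single_add_induct)
  case (single_add m c p)
  have "mpoly_eval (Poly_Mapping.single m c * q) x =
      mpoly_eval (Poly_Mapping.single m c) x * mpoly_eval q x"
    by (induction q rule: poly_mapping_single_add_induct)
      (simp_all add: mult_single lookup_add power_add prod.distrib distrib_left)
  then show ?case
    using single_add by (simp add: distrib_right del: mpoly_eval_single)
qed simp

lemma mpoly_eval_sum: "mpoly_eval (\<Sum>a\<in>S. p a) x = (\<Sum>a\<in>S. mpoly_eval (p a) x)"
  by (induction S rule: infinite_finite_induct) simp_all

lemma mpoly_eval_prod: "mpoly_eval (\<Prod>a\<in>S. p a) x = (\<Prod>a\<in>S. mpoly_eval (p a) x)"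
  by (induction S rule: infinite_finite_induct) simp_all

lemma mpoly_eval_const [simp]: "mpoly_eval (mpoly_const c) x = c"
  by (simp add: mpoly_const_def)

lemma mpoly_eval_var [simp]: "mpoly_eval (mpoly_var i) x = x $ i"
proof -
  have "(\<Prod>j\<in>UNIV. (x $ j) ^ Poly_Mapping.lookup (Poly_Mapping.single i (1::nat)) j)
      = (\<Prod>j\<in>UNIV. if j = i then x $ j else 1)"
    by (intro prod.cong) (auto simp: lookup_single when_def)
  then show ?thesis
    by (simp add: mpoly_var_def)
qed

lemma mpoly_eval_q_poly:
  "mpoly_eval (q_poly A) x = det ((\<chi> i j. if i = j then x $ i else 0) + A)"
proof -
  have "mpoly_eval (of_int (sign p)) x = of_int (sign p)" for p :: "'a \<Rightarrow> 'a"
    by (simp add: sign_def)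
  then show ?thesis
    by (simp add: q_poly_def det_def mpoly_eval_sum mpoly_eval_prod
        if_distrib[of "\<lambda>p. mpoly_eval p x"] cong: if_cong)
qed

end

theory Submission
  imports Defs
begin

text \<open>
  Expanding \<open>det (diag x + A)\<close> along the diagonal variables gives
  \<open>\<Sum>S. principal_minor A (- S) * (\<Prod>i\<in>S. x i)\<close> for every square matrix \<open>A\<close>
  (\<open>q_poly_expansion\<close>). Hence the polynomial is multi-affine, it is nonzero because the
  coefficient of \<open>\<Prod>i. x i\<close> is the empty minor 1, and its coefficients are
  nonnegative when the principal minors of \<open>A\<close> are.

  For the Garding property of a Z-matrix \<open>A\<close>, the component of positivity is the set of those
  \<open>x\<close> for which \<open>diag x + A\<close> is a nonsingular M-matrix. The characterization
  of these matrices that makes everything elementary is semipositivity: some vector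
  \<open>v > 0\<close> has \<open>(diag x + A) v > 0\<close> in every entry. For a fixed \<open>v\<close> this is a
  finite system of strict linear inequalities in \<open>x\<close>, which stays valid when \<open>x\<close>
  increases, so the set of all such \<open>x\<close> is open, closed under adding nonnegative vectors, and
  connected (it is a union of convex sets any two of which meet).

  Semipositivity forces the inverse of a Z-matrix to be nonnegative
  (\<open>Z_matrix_inverse_nonneg\<close>), and this yields the two facts that tie the set to the
  determinant. The determinant is positive on the set (\<open>Z_matrix_det_pos\<close>), because it
  cannot vanish along the segment from the matrix to the identity. And a boundary point at
  which the determinant does not vanish already belongs to the set
  (\<open>semipositive_shifts_relatively_closed\<close>). So the set is connected, and open and
  closed relative to the region where the determinant is positive; that is, it is a component.
\<close>

section \<open>The coefficients of the determinantal polynomial\<close>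

definition squarefree_exponent :: "'n::finite set \<Rightarrow> ('n \<Rightarrow>\<^sub>0 nat)" where
  "squarefree_exponent S = (\<Sum>i\<in>S. Poly_Mapping.single i 1)"

lemma lookup_squarefree_exponent:
  "Poly_Mapping.lookup (squarefree_exponent S) i = of_bool (i \<in> S)"
  by (simp add: squarefree_exponent_def lookup_sum lookup_single when_def)

lemma inj_squarefree_exponent: "inj squarefree_exponent"
proof (rule injI)
  fix S T :: "'n::finite set"
  assume "squarefree_exponent S = squarefree_exponent T"
  then have "Poly_Mapping.lookup (squarefree_exponent S) i =
      Poly_Mapping.lookup (squarefree_exponent T) i" for i
    by simp
  then show "S = T"
    by (simp add: lookup_squarefree_exponent of_bool_eq_iff set_eq_iff)
qed

lemma prod_mpoly_var: "(\<Prod>i\<in>S. mpoly_var i) = Poly_Mapping.single (squarefree_exponent S) 1"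
proof -
  have "finite S" by simp
  then show ?thesis
    by induction (simp_all add: squarefree_exponent_def mpoly_var_def mult_single)
qed

lemma mpoly_const_1: "mpoly_const 1 = 1"
  by (simp add: mpoly_const_def)

lemma mpoly_const_uminus: "mpoly_const (- a) = - mpoly_const a"
  by (simp add: mpoly_const_def single_uminus)

lemma mpoly_const_mult: "mpoly_const (a * b) = mpoly_const a * mpoly_const b"
  by (simp add: mpoly_const_def mult_single)

lemma mpoly_const_sum: "mpoly_const (\<Sum>i\<in>S. f i) = (\<Sum>i\<in>S. mpoly_const (f i))"
  by (induction S rule: infinite_finite_induct) (simp_all add: mpoly_const_def single_add)

lemma mpoly_const_prod: "mpoly_const (\<Prod>i\<in>S. f i) = (\<Prod>i\<in>S. mpoly_const (f i))"
  by (induction S rule: infinite_finite_induct) (simp_all add: mpoly_const_1 mpoly_const_mult)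

lemma mpoly_const_sign: "mpoly_const (of_int (sign p)) = of_int (sign p)"
  by (simp add: sign_def mpoly_const_1 mpoly_const_uminus)

lemma permutes_Compl_iff: "p permutes - S \<longleftrightarrow> p permutes UNIV \<and> (\<forall>i\<in>S. p i = i)"
  by (auto simp: permutes_def)

text \<open>
  In the Leibniz formula each row contributes either its variable or its constant. Choosing the
  variables exactly in the rows of \<open>S\<close> leaves only the permutations that fix \<open>S\<close>
  pointwise, and these are the permutations in the minor of the complement.
\<close>

lemma q_poly_expansion:
  "q_poly A = (\<Sum>S\<in>UNIV. Poly_Mapping.single (squarefree_exponent S) (principal_minor A (- S)))"
proof -
  have row: "(\<Prod>i\<in>UNIV. ((\<chi> i j. if i = j then mpoly_var i else 0) +
        (\<chi> i j. mpoly_const (A $ i $ j))) $ i $ p i) =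
      (\<Sum>S\<in>UNIV. if p permutes - S
        then (\<Prod>i\<in>S. mpoly_var i) * (\<Prod>i\<in>- S. mpoly_const (A $ i $ p i)) else 0)"
    if p: "p permutes UNIV" for p :: "'a \<Rightarrow> 'a"
  proof -
    have "(\<Prod>i\<in>UNIV. ((\<chi> i j. if i = j then mpoly_var i else 0) +
        (\<chi> i j. mpoly_const (A $ i $ j))) $ i $ p i) =
      (\<Sum>S\<in>Pow UNIV. (\<Prod>i\<in>S. if i = p i then mpoly_var i else 0) *
        (\<Prod>i\<in>UNIV - S. mpoly_const (A $ i $ p i)))"
      by (simp add: prod_add)
    also have "\<dots> = (\<Sum>S\<in>UNIV. if p permutes - S
        then (\<Prod>i\<in>S. mpoly_var i) * (\<Prod>i\<in>- S. mpoly_const (A $ i $ p i)) else 0)"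
    proof (rule sum.cong)
      fix S :: "'a set"
      show "(\<Prod>i\<in>S. if i = p i then mpoly_var i else 0) *
          (\<Prod>i\<in>UNIV - S. mpoly_const (A $ i $ p i)) =
        (if p permutes - S
         then (\<Prod>i\<in>S. mpoly_var i) * (\<Prod>i\<in>- S. mpoly_const (A $ i $ p i)) else 0)"
      proof (cases "\<forall>i\<in>S. p i = i")
        case True
        then have "(\<Prod>i\<in>S. if i = p i then mpoly_var i else 0) = (\<Prod>i\<in>S. mpoly_var i)"
          by (intro prod.cong) auto
        then show ?thesis
          using True p by (simp add: permutes_Compl_iff flip: Compl_eq_Diff_UNIV)
      next
        case False
        then have "(\<Prod>i\<in>S. if i = p i then mpoly_var i else 0 :: 'a real_mpoly) = 0"
          by (intro prod_zero) (simp, metis)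
        then show ?thesis
          using False by (auto simp: permutes_Compl_iff)
      qed
    qed simp
    finally show ?thesis .
  qed
  have "q_poly A = (\<Sum>p | p permutes UNIV. of_int (sign p) *
      (\<Sum>S\<in>UNIV. if p permutes - S
        then (\<Prod>i\<in>S. mpoly_var i) * (\<Prod>i\<in>- S. mpoly_const (A $ i $ p i)) else 0))"
    unfolding q_poly_def det_def by (intro sum.cong refl) (simp only: row mem_Collect_eq)
  also have "\<dots> = (\<Sum>S\<in>UNIV. \<Sum>p | p permutes UNIV. if p permutes - S
      then of_int (sign p) * ((\<Prod>i\<in>S. mpoly_var i) * (\<Prod>i\<in>- S. mpoly_const (A $ i $ p i)))
      else 0)"
    unfolding sum_distrib_left
    by (subst sum.swap) (intro sum.cong refl, simp)
  also have "\<dots> = (\<Sum>S\<in>UNIV. (\<Prod>i\<in>S. mpoly_var i) * mpoly_const (principal_minor A (- S)))"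
  proof (intro sum.cong refl)
    fix S :: "'a set"
    have "(\<Sum>p | p permutes UNIV. if p permutes - S
        then of_int (sign p) * ((\<Prod>i\<in>S. mpoly_var i) * (\<Prod>i\<in>- S. mpoly_const (A $ i $ p i)))
        else 0) =
      (\<Sum>p | p permutes - S. of_int (sign p) *
        ((\<Prod>i\<in>S. mpoly_var i) * (\<Prod>i\<in>- S. mpoly_const (A $ i $ p i))))"
      by (subst sum.inter_filter[symmetric])
        (auto intro!: sum.cong simp: permutes_Compl_iff)
    also have "\<dots> = (\<Prod>i\<in>S. mpoly_var i) * mpoly_const (principal_minor A (- S))"
      by (simp add: principal_minor_def mpoly_const_sum mpoly_const_mult mpoly_const_prod
          mpoly_const_sign sum_distrib_left mult_ac)
    finally show "(\<Sum>p | p permutes UNIV. if p permutes - S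
        then of_int (sign p) * ((\<Prod>i\<in>S. mpoly_var i) * (\<Prod>i\<in>- S. mpoly_const (A $ i $ p i)))
        else 0) = (\<Prod>i\<in>S. mpoly_var i) * mpoly_const (principal_minor A (- S))" .
  qed
  finally show ?thesis
    by (simp add: prod_mpoly_var mpoly_const_def mult_single)
qed

lemma lookup_q_poly:
  "Poly_Mapping.lookup (q_poly A) m =
    (\<Sum>S\<in>UNIV. principal_minor A (- S) when squarefree_exponent S = m)"
  by (simp add: q_poly_expansion lookup_sum lookup_single)

lemma multi_affine_q_poly: "multi_affine (q_poly A)"
  unfolding multi_affine_def
proof (intro ballI allI)
  fix m i assume "m \<in> Poly_Mapping.keys (q_poly A)"
  then have "Poly_Mapping.lookup (q_poly A) m \<noteq> 0"
    by (simp add: in_keys_iff)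
  then obtain S where "squarefree_exponent S = m"
    unfolding lookup_q_poly
    by (elim sum.not_neutral_contains_not_neutral) (auto simp: when_def split: if_splits)
  then show "Poly_Mapping.lookup m i \<le> 1"
    by (auto simp: lookup_squarefree_exponent)
qed

lemma nonneg_coeffs_q_poly:
  assumes "\<And>S. 0 \<le> principal_minor A S"
  shows "nonneg_coeffs (q_poly A)"
  using assms by (simp add: nonneg_coeffs_def lookup_q_poly sum_nonneg when_def)

lemma q_poly_nonzero: "q_poly A \<noteq> 0"
proof -
  have "Poly_Mapping.lookup (q_poly A) (squarefree_exponent UNIV) =
      (\<Sum>S\<in>UNIV. if S = UNIV then principal_minor A (- S) else 0)"
    unfolding lookup_q_poly
    by (intro sum.cong) (auto simp: when_def inj_eq[OF inj_squarefree_exponent])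
  also have "\<dots> = 1"
    by (simp add: principal_minor_def)
  finally show ?thesis
    by auto
qed

section \<open>Z-matrices that map some positive vector to a positive vector\<close>

text \<open>
  Subtract from \<open>w\<close> the multiple \<open>c v\<close> with \<open>c\<close> the least ratio
  \<open>w i / v i\<close>, attained at \<open>k\<close>. The difference is nonnegative and vanishes at
  \<open>k\<close>, so the sign pattern makes row \<open>k\<close> of its image nonpositive; a negative
  \<open>c\<close> would make the same entry positive.
\<close>

lemma Z_matrix_inverse_nonneg:
  fixes M :: "real ^ 'n ^ 'n"
  assumes Z: "Z_matrix M"
    and v: "\<And>i. 0 < v $ i" and Mv: "\<And>i. 0 < (M *v v) $ i"
    and Mw: "\<And>i. 0 \<le> (M *v w) $ i"
  shows "0 \<le> w $ i"
proof (rule ccontr)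
  assume neg: "\<not> 0 \<le> w $ i"
  define c where "c = Min (range (\<lambda>j. w $ j / v $ j))"
  have c_le: "c \<le> w $ j / v $ j" for j
    by (simp add: c_def)
  have "c \<in> range (\<lambda>j. w $ j / v $ j)"
    unfolding c_def by (intro Min_in) auto
  then obtain k where k: "c = w $ k / v $ k"
    by auto
  have c_neg: "c < 0"
    using c_le[of i] neg v[of i] by (smt (verit) divide_neg_pos)
  define u where "u = w - c *\<^sub>R v"
  have u_nonneg: "0 \<le> u $ j" for j
    using c_le[of j] v[of j] by (simp add: u_def field_simps)
  have u_k: "u $ k = 0"
    using v[of k] k by (simp add: u_def)
  have "M $ k $ j * u $ j \<le> 0" for j
    using Z u_nonneg[of j] u_k
    by (cases "j = k") (auto simp: Z_matrix_def mult_nonpos_nonneg)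
  then have "(M *v u) $ k \<le> 0"
    by (simp add: matrix_vector_mult_def sum_nonpos)
  moreover have "(M *v u) $ k = (M *v w) $ k - c * (M *v v) $ k"
    by (simp add: u_def matrix_vector_mult_diff_distrib matrix_vector_mult_scaleR)
  ultimately show False
    using Mw[of k] mult_neg_pos[OF c_neg Mv[of k]] by linarith
qed

text \<open>A kernel vector and its negative are both nonnegative by the preceding lemma.\<close>

lemma Z_matrix_invertible:
  fixes M :: "real ^ 'n ^ 'n"
  assumes "Z_matrix M" "\<And>i. 0 < v $ i" "\<And>i. 0 < (M *v v) $ i"
  shows "det M \<noteq> 0"
proof -
  have "z = 0" if "M *v z = 0" for z
  proof -
    have "M *v (- z) = 0"
      using that by (metis neg_0_equal_iff_equal scaleR_minus1_left matrix_vector_mult_scaleR)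
    then have "0 \<le> z $ i" "0 \<le> (- z) $ i" for i
      using Z_matrix_inverse_nonneg[OF assms, of z i]
        Z_matrix_inverse_nonneg[OF assms, of "- z" i] that by auto
    then show ?thesis
      by (simp add: vec_eq_iff order_antisym)
  qed
  then have "invertible M"
    by (metis invertible_left_inverse matrix_left_invertible_ker)
  then show ?thesis
    by (simp add: invertible_det_nz)
qed

text \<open>
  The hypotheses, with the same \<open>v\<close>, hold along the whole segment from \<open>M\<close> to the
  identity matrix. The determinant has no zero there, and at the end it is 1.
\<close>

lemma Z_matrix_det_pos:
  fixes M :: "real ^ 'n ^ 'n"
  assumes Z: "Z_matrix M" and v: "\<And>i. 0 < v $ i" and Mv: "\<And>i. 0 < (M *v v) $ i"
  shows "0 < det M"
proof (rule ccontr)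
  assume neg: "\<not> 0 < det M"
  define H where "H t = (1 - t) *\<^sub>R M + t *\<^sub>R mat 1" for t :: real
  have "continuous_on {0..1} (\<lambda>t. det (H t))"
    unfolding det_def H_def by (simp, intro continuous_intros)
  moreover have "det (H 0) \<le> 0" "0 \<le> det (H 1)"
    using neg by (simp_all add: H_def)
  ultimately obtain t where t: "0 \<le> t" "t \<le> 1" "det (H t) = 0"
    using IVT'[of "\<lambda>t. det (H t)" 0 0 1] by auto
  have "Z_matrix (H t)"
    using Z t by (auto simp: Z_matrix_def H_def mat_def mult_nonneg_nonpos)
  moreover have "0 < (H t *v v) $ i" for i
  proof -
    have "(H t *v v) $ i = (1 - t) * (M *v v) $ i + t * v $ i"
      by (simp add: H_def matrix_vector_mult_add_rdistrib scaleR_matrix_vector_assoc[symmetric])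
    moreover have "0 < (1 - t) * (M *v v) $ i + t * v $ i"
      using t Mv[of i] v[of i] by (cases "t = 0") (auto intro!: add_nonneg_pos)
    ultimately show ?thesis
      by simp
  qed
  ultimately show False
    using Z_matrix_invertible[of "H t" v] v t by blast
qed

section \<open>The component of positivity\<close>

definition add_diag :: "real ^ 'n \<Rightarrow> real ^ 'n ^ 'n \<Rightarrow> real ^ 'n ^ 'n" where
  "add_diag x A = (\<chi> i j. if i = j then x $ i else 0) + A"

lemma add_diag_mult:
  fixes A :: "real ^ 'n ^ 'n"
  shows "(add_diag x A *v v) $ i = x $ i * v $ i + (A *v v) $ i"
  by (simp add: add_diag_def matrix_vector_mult_def distrib_right sum.distrib
      if_distrib[of "\<lambda>a. a * _"] cong: if_cong)

lemma Z_matrix_add_diag: "Z_matrix A \<Longrightarrow> Z_matrix (add_diag x A)"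
  by (simp add: Z_matrix_def add_diag_def)

text \<open>
  Fixing the vector \<open>v\<close> makes the condition on \<open>x\<close> a finite intersection of open
  halfspaces.
\<close>

definition witnessed_shifts :: "real ^ 'n ^ 'n \<Rightarrow> real ^ 'n \<Rightarrow> (real ^ 'n) set" where
  "witnessed_shifts A v = {x. \<forall>i. 0 < (add_diag x A *v v) $ i}"

text \<open>
  For a Z-matrix \<open>A\<close> these are the \<open>x\<close> for which the shifted matrix is a
  nonsingular M-matrix.
\<close>

definition semipositive_shifts :: "real ^ 'n ^ 'n \<Rightarrow> (real ^ 'n) set" where
  "semipositive_shifts A = (\<Union>v\<in>pos_orthant. witnessed_shifts A v)"

lemma witnessed_shifts_halfspaces:
  fixes A :: "real ^ 'n ^ 'n"
  shows "witnessed_shifts A v = (\<Inter>i. {x. axis i (v $ i) \<bullet> x > - (A *v v) $ i})"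
  by (auto simp: witnessed_shifts_def add_diag_mult inner_axis' mult.commute
      add.commute less_diff_eq minus_less_iff)
    (smt (verit))+

lemma open_semipositive_shifts: "open (semipositive_shifts (A :: real ^ 'n ^ 'n))"
  unfolding semipositive_shifts_def witnessed_shifts_halfspaces
  by (intro open_UN ballI open_INT open_halfspace_gt) auto

lemma convex_witnessed_shifts: "convex (witnessed_shifts (A :: real ^ 'n ^ 'n) v)"
  unfolding witnessed_shifts_halfspaces by (intro convex_INT convex_halfspace_gt)

text \<open>
  For positive \<open>v\<close> each condition bounds every coordinate of \<open>x\<close> from below only.
\<close>

lemma witnessed_shifts_meet:
  fixes A :: "real ^ 'n ^ 'n"
  assumes "v \<in> pos_orthant" "w \<in> pos_orthant"
  shows "witnessed_shifts A v \<inter> witnessed_shifts A w \<noteq> {}"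
proof -
  define x :: "real ^ 'n" where
    "x = (\<chi> i. max (- (A *v v) $ i / v $ i) (- (A *v w) $ i / w $ i) + 1)"
  have "- (A *v u) $ i / u $ i < x $ i" if "u = v \<or> u = w" for u i
    using that by (auto simp: x_def)
  moreover have "0 < u $ i" if "u = v \<or> u = w" for u i
    using that assms by (auto simp: pos_orthant_def)
  ultimately have "0 < x $ i * u $ i + (A *v u) $ i" if "u = v \<or> u = w" for u i
    using that by (smt (verit) pos_divide_less_eq)
  then have "x \<in> witnessed_shifts A v \<inter> witnessed_shifts A w"
    by (auto simp: witnessed_shifts_def add_diag_mult)
  then show ?thesis
    by blast
qed

lemma one_in_pos_orthant: "1 \<in> pos_orthant"
  by (simp add: pos_orthant_def)

lemma semipositive_shifts_nonempty: "semipositive_shifts (A :: real ^ 'n ^ 'n) \<noteq> {}"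
  using witnessed_shifts_meet[OF one_in_pos_orthant one_in_pos_orthant, of A] one_in_pos_orthant
  by (auto simp: semipositive_shifts_def)

lemma connected_semipositive_shifts: "connected (semipositive_shifts (A :: real ^ 'n ^ 'n))"
proof -
  have "connected (witnessed_shifts A 1 \<union> \<Union> (witnessed_shifts A ` pos_orthant))"
    using convex_witnessed_shifts[of A] witnessed_shifts_meet[OF one_in_pos_orthant, of _ A]
    by (intro connected_Un_UN) (auto intro: convex_connected)
  moreover have "witnessed_shifts A 1 \<union> \<Union> (witnessed_shifts A ` pos_orthant) = semipositive_shifts A"
    using one_in_pos_orthant by (auto simp: semipositive_shifts_def)
  ultimately show ?thesis
    by simp
qed

lemma semipositive_shifts_upward:
  fixes A :: "real ^ 'n ^ 'n"
  assumes "x \<in> semipositive_shifts A" "\<And>i. x $ i \<le> y $ i"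
  shows "y \<in> semipositive_shifts A"
proof -
  obtain v where v: "v \<in> pos_orthant" and x: "\<And>i. 0 < x $ i * v $ i + (A *v v) $ i"
    using assms(1) by (auto simp: semipositive_shifts_def witnessed_shifts_def add_diag_mult)
  have "x $ i * v $ i \<le> y $ i * v $ i" for i
    using v assms(2)[of i] by (simp add: pos_orthant_def mult_right_mono less_imp_le)
  then have "0 < y $ i * v $ i + (A *v v) $ i" for i
    using x[of i] by (smt (verit))
  then show ?thesis
    using v by (auto simp: semipositive_shifts_def witnessed_shifts_def add_diag_mult)
qed

lemma semipositive_shifts_det_pos:
  fixes A :: "real ^ 'n ^ 'n"
  assumes "Z_matrix A" "x \<in> semipositive_shifts A"
  shows "0 < det (add_diag x A)"
  using assms Z_matrix_det_pos[OF Z_matrix_add_diag[OF assms(1)]]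
  by (auto simp: semipositive_shifts_def witnessed_shifts_def pos_orthant_def)

text \<open>
  Let \<open>w\<close> be the solution of \<open>(diag x + A) w = 1\<close>, the vector of ones. Points of
  the set arbitrarily near \<open>x\<close> lie below \<open>x + e 1\<close>, so the latter is in the set for
  every \<open>e > 0\<close>. For small \<open>e\<close> the vector \<open>w\<close> still has a nonnegative image
  under the matrix shifted by \<open>x + e 1\<close>, hence \<open>w\<close> is nonnegative. A zero entry
  of \<open>w\<close> would make the corresponding entry of the image nonpositive instead of 1, so
  \<open>w\<close> is positive and is itself a witness for \<open>x\<close>. Fixing \<open>w\<close> before
  \<open>e\<close> avoids taking a limit of inverse matrices.
\<close>

lemma semipositive_shifts_relatively_closed:
  fixes A :: "real ^ 'n ^ 'n"
  assumes Z: "Z_matrix A" and x: "x \<in> closure (semipositive_shifts A)" and det: "det (add_diag x A) \<noteq> 0"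
  shows "x \<in> semipositive_shifts A"
proof -
  let ?M = "add_diag x A"
  obtain N where "?M ** N = mat 1"
    using det by (metis invertible_det_nz invertible_right_inverse)
  then have Mw: "?M *v (N *v 1) = 1"
    by (simp add: matrix_vector_mul_assoc)
  define w where "w = N *v 1"
  \<comment> \<open>Small enough that \<open>1 + e w\<close>, the image of \<open>w\<close> after the extra shift, is nonnegative.\<close>
  define e where "e = 1 / (1 + norm w)"
  have e: "0 < e"
    by (simp add: e_def add_pos_nonneg)
  obtain u where u: "u \<in> semipositive_shifts A" "dist u x < e"
    using x e by (meson closure_approachable)
  have "u $ i \<le> (x + e *\<^sub>R 1) $ i" for i
    using component_le_norm_cart[of "u - x" i] u(2) by (simp add: dist_norm)
  then have "x + e *\<^sub>R 1 \<in> semipositive_shifts A"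
    by (rule semipositive_shifts_upward[OF u(1)])
  then obtain v where v: "\<And>i. 0 < v $ i" "\<And>i. 0 < (add_diag (x + e *\<^sub>R 1) A *v v) $ i"
    by (auto simp: semipositive_shifts_def witnessed_shifts_def pos_orthant_def)
  have Mw_i: "x $ i * w $ i + (A *v w) $ i = 1" for i
    using Mw by (simp add: w_def flip: add_diag_mult)
  have "0 \<le> (add_diag (x + e *\<^sub>R 1) A *v w) $ i" for i
  proof -
    have "- norm w \<le> w $ i"
      using component_le_norm_cart[of w i] by linarith
    then have "e * (- norm w) \<le> e * w $ i"
      using e by (intro mult_left_mono) auto
    moreover have "e * norm w \<le> 1"
      by (simp add: e_def divide_le_eq add_pos_nonneg)
    ultimately show ?thesis
      using Mw_i[of i] by (simp add: add_diag_mult distrib_right)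
  qed
  then have w_nonneg: "0 \<le> w $ i" for i
    by (rule Z_matrix_inverse_nonneg[OF Z_matrix_add_diag[OF Z] v])
  have "w $ i \<noteq> 0" for i
  proof
    assume w_i: "w $ i = 0"
    have "A $ i $ j * w $ j \<le> 0" for j
      using Z w_nonneg[of j] w_i
      by (cases "j = i") (auto simp: Z_matrix_def mult_nonpos_nonneg)
    then have "(A *v w) $ i \<le> 0"
      by (simp add: matrix_vector_mult_def sum_nonpos)
    then show False
      using Mw_i[of i] w_i by simp
  qed
  then have "w \<in> pos_orthant"
    using w_nonneg by (simp add: pos_orthant_def less_le)
  moreover have "x \<in> witnessed_shifts A w"
    using Mw_i by (simp add: witnessed_shifts_def add_diag_mult)
  ultimately show ?thesis
    by (auto simp: semipositive_shifts_def)
qed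

lemma relatively_clopen_in_components:
  fixes U S :: "'a::topological_space set"
  assumes "connected U" "U \<noteq> {}" "U \<subseteq> S" "open U" "closure U \<inter> S \<subseteq> U"
  shows "U \<in> components S"
proof -
  obtain C where C: "C \<in> components S" "U \<subseteq> C"
    using exists_component_superset[of U S] assms(1-3) by auto
  have "C \<subseteq> S" "connected C"
    using C in_components_subset in_components_connected by auto
  have "openin (top_of_set C) U"
    using assms(4) C(2) by (simp add: open_subset)
  moreover have "U = C \<inter> closure U"
    using C(2) \<open>C \<subseteq> S\<close> assms(5) closure_subset by blast
  then have "closedin (top_of_set C) U"
    by (metis closed_closure closedin_closed_Int)
  ultimately have "U = C"
    using \<open>connected C\<close> assms(2) connected_clopen by blast
  then show ?thesis
    using C by simp
qed

lemma closure_pos_orthant_nonneg: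
  fixes y :: "real ^ 'n"
  assumes "y \<in> closure pos_orthant"
  shows "0 \<le> y $ i"
proof -
  have "closed {z :: real ^ 'n. 0 \<le> z $ i}"
    by (intro closed_Collect_le continuous_intros)
  moreover have "pos_orthant \<subseteq> {z :: real ^ 'n. 0 \<le> z $ i}"
    by (auto simp: pos_orthant_def less_imp_le)
  ultimately show ?thesis
    using assms closure_minimal by blast
qed

lemma garding_q_poly:
  fixes A :: "real ^ 'n ^ 'n"
  assumes Z: "Z_matrix A"
  shows "garding (q_poly A)"
proof -
  let ?S = "{x. 0 < mpoly_eval (q_poly A) x}"
  have eval: "mpoly_eval (q_poly A) x = det (add_diag x A)" for x
    by (simp add: mpoly_eval_q_poly add_diag_def)
  have "semipositive_shifts A \<in> components ?S"
  proof (rule relatively_clopen_in_components)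
    show "semipositive_shifts A \<subseteq> ?S"
      using semipositive_shifts_det_pos[OF Z] by (auto simp: eval)
    show "closure (semipositive_shifts A) \<inter> ?S \<subseteq> semipositive_shifts A"
      using semipositive_shifts_relatively_closed[OF Z] by (auto simp: eval)
  qed (simp_all add: connected_semipositive_shifts semipositive_shifts_nonempty open_semipositive_shifts)
  moreover have "x + y \<in> semipositive_shifts A" if "x \<in> semipositive_shifts A" "y \<in> closure pos_orthant" for x y
    using closure_pos_orthant_nonneg[OF that(2)]
    by (intro semipositive_shifts_upward[OF that(1)]) simp
  ultimately show ?thesis
    using q_poly_nonzero multi_affine_q_poly unfolding garding_def by blast
qed

theorem theorem16p1:
  fixes A :: "real ^ 'n ^ 'n"
  shows "(Z_matrix A \<longrightarrow> multi_affine (q_poly A) \<and> garding (q_poly A)) \<and>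
    (M_matrix A \<longrightarrow> multi_affine (q_poly A) \<and> garding (q_poly A) \<and> nonneg_coeffs (q_poly A))"
  by (simp add: M_matrix_def multi_affine_q_poly garding_q_poly nonneg_coeffs_q_poly)

end
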